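(* Let $\Gamma$ be a locally finite graph, $F$ a field with an absolute value $|\cdot|_{\rm v}$, $\lambda\in F$ and $v\in V(\Gamma)$. If $X_i$, $i\in I$, is a non-empty family, linearly ordered by inclusion, of subsets of $V(\Gamma)$ each of which contains $v$ and is the support of an eigenfunction of $A_{\Gamma,F}$ corresponding to the eigenvalue $\lambda$, then some subset of $\bigcap_{i\in I}X_i$ contains $v$ and is the support of an eigenfunction of $A_{\Gamma,F}$ corresponding to the eigenvalue $\lambda$. Consequently, every support containing $v$ of an eigenfunction of $A_{\Gamma,F}$ corresponding to the eigenvalue $\lambda$ contains a set that is minimal with respect to inclusion among the supports containing $v$ of eigenfunctions of $A_{\Gamma,F}$ corresponding to the eigenvalue $\lambda$.
   Context: A graph is an undirected graph without loops or multiple edges, with vertex set $V(\Gamma)$; $\Gamma(v)$ is the set of vertices adjacent to $v$. $\Gamma$ is locally finite if every $\Gamma(v)$ is finite (it may be infinite and disconnected). $F^{V(\Gamma)}$ is the $F$-vector space of all functions $V(\Gamma)\to F$, and $A_{\Gamma,F}:F^{V(\Gamma)}\to F^{V(\Gamma)}$ is the linear operator $(A_{\Gamma,F}(f))(v)=\sum_{u\in\Gamma(v)}f(u)$. The absolute value may be trivial. An eigenfunction corresponding to the eigenvalue $\lambda$ is a nonzero $f$ with $A_{\Gamma,F}(f)=\lambda f$. The support of $f$ is $\{u: f(u)\neq 0\}$. *)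

theory Defs
  imports Complex_Main "HOL-Library.FuncSet"
begin

definition simple_graph :: "'v set \<Rightarrow> 'v set set \<Rightarrow> bool" where
  "simple_graph V E \<longleftrightarrow> E \<subseteq> {{u, w} | u w. u \<in> V \<and> w \<in> V \<and> u \<noteq> w}"

definition nbrs :: "'v set set \<Rightarrow> 'v \<Rightarrow> 'v set" where
  "nbrs E v = {u. {u, v} \<in> E}"

definition locally_finite_graph :: "'v set \<Rightarrow> 'v set set \<Rightarrow> bool" where
  "locally_finite_graph V E \<longleftrightarrow> simple_graph V E \<and> (\<forall>v\<in>V. finite (nbrs E v))"

definition absolute_value :: "('f::field \<Rightarrow> real) \<Rightarrow> bool" where
  "absolute_value a \<longleftrightarrow>
     (\<forall>x. 0 \<le> a x) \<and> (\<forall>x. a x = 0 \<longleftrightarrow> x = 0) \<and>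
     (\<forall>x y. a (x * y) = a x * a y) \<and> (\<forall>x y. a (x + y) \<le> a x + a y)"

text \<open>The space of functions from \<open>V\<close> to the field is represented by \<open>V \<rightarrow>\<^sub>E UNIV\<close>, so that
  functions on \<open>V\<close> are equal iff they agree on \<open>V\<close>; its zero vector is \<open>\<lambda>v\<in>V. 0\<close>.\<close>

definition adj_op :: "'v set \<Rightarrow> 'v set set \<Rightarrow> ('v \<Rightarrow> 'f::field) \<Rightarrow> 'v \<Rightarrow> 'f" where
  "adj_op V E f = (\<lambda>v\<in>V. \<Sum>u\<in>nbrs E v. f u)"

definition eigenfunction :: "'v set \<Rightarrow> 'v set set \<Rightarrow> 'f::field \<Rightarrow> ('v \<Rightarrow> 'f) \<Rightarrow> bool" where
  "eigenfunction V E \<mu> f \<longleftrightarrow>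
     f \<in> V \<rightarrow>\<^sub>E UNIV \<and> f \<noteq> (\<lambda>v\<in>V. 0) \<and> adj_op V E f = (\<lambda>v\<in>V. \<mu> * f v)"

definition supp :: "'v set \<Rightarrow> ('v \<Rightarrow> 'f::zero) \<Rightarrow> 'v set" where
  "supp V f = {u\<in>V. f u \<noteq> 0}"

definition eigen_supports_at :: "'v set \<Rightarrow> 'v set set \<Rightarrow> 'f::field \<Rightarrow> 'v \<Rightarrow> 'v set set" where
  "eigen_supports_at V E \<mu> v = {supp V f | f. eigenfunction V E \<mu> f \<and> v \<in> supp V f}"

end

theory Submission
  imports Defs "HOL-Library.Function_Algebras"
begin

text \<open>
  Fixing the value \<open>f v = 1\<close> turns the first claim into the solvability of a linear system: the
  unknowns are the values \<open>f u\<close>, and the homogeneous equations are \<open>A f = \<mu> f\<close> at every vertex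
  together with \<open>f u = 0\<close> for every \<open>u\<close> outside the intersection \<open>\<Inter>\<C>\<close> of the given chain \<open>\<C>\<close> of
  supports. Local finiteness makes each of these equations involve finitely many unknowns only.

  Such systems obey a compactness principle over any field (lemma \<open>linear_compactness\<close>): if every
  finite subsystem has a solution with \<open>f v \<noteq> 0\<close>, so does the whole system. Indeed, solutions are
  the same thing as linear functionals that kill the coefficient functions of the equations, and a
  functional with value 1 at the coordinate function \<open>\<delta>\<^sub>v\<close> exists unless \<open>\<delta>\<^sub>v\<close> is in the
  span of the coefficient functions; a relation witnessing that involves finitely many equations.

  A finite subsystem prescribes zeros at finitely many vertices outside \<open>\<Inter>\<C>\<close>. As \<open>\<C>\<close> is a chain,
  one of its members avoids all of them, and an eigenfunction with this support solves the
  subsystem. The second claim follows from the first by Zorn's lemma for reverse inclusion.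
\<close>

section \<open>Compactness of linear systems with finitely many unknowns in each equation\<close>

text \<open>The sum runs over the support of \<open>g\<close>, the coefficient function of an equation, so it is
  meaningful for finitely supported \<open>g\<close> and arbitrary \<open>f\<close>; elsewhere the default value 0 of
  infinite sums applies.\<close>

definition pairing :: "('v \<Rightarrow> 'f::field) \<Rightarrow> ('v \<Rightarrow> 'f) \<Rightarrow> 'f" where
  "pairing f g = (\<Sum>u | g u \<noteq> 0. g u * f u)"

definition delta :: "'v \<Rightarrow> 'v \<Rightarrow> 'f::field" where
  "delta w = (\<lambda>u. if u = w then 1 else 0)"

lemma pairing_superset:
  assumes "finite A" "{u. g u \<noteq> 0} \<subseteq> A"
  shows "pairing f g = (\<Sum>u\<in>A. g u * f u)"
  unfolding pairing_def using assms by (intro sum.mono_neutral_left) auto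

lemma supp_delta: "{u. delta w u \<noteq> (0::'f::field)} = {w}"
  by (auto simp: delta_def)

lemma pairing_delta: "pairing f (delta w) = f w"
  unfolding pairing_def supp_delta by (simp add: delta_def)

lemma inj_delta: "inj (delta :: 'v \<Rightarrow> 'v \<Rightarrow> 'f::field)"
proof (rule injI)
  fix x y :: 'v
  assume "delta x = (delta y :: 'v \<Rightarrow> 'f)"
  then have "delta x x = (delta y x :: 'f)" by simp
  then show "x = y" by (simp add: delta_def split: if_splits)
qed

lemma vector_space_fun: "vector_space (\<lambda>(c::'f::field) (g::'v \<Rightarrow> 'f) u. c * g u)"
  by unfold_locales (auto simp: algebra_simps fun_eq_iff)

lemma sum_fun_apply: "(\<Sum>i\<in>A. h i) u = (\<Sum>i\<in>A. h i u)" for h :: "'i \<Rightarrow> 'v \<Rightarrow> 'f::field"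
  by (induction A rule: infinite_finite_induct) auto

lemma sum_scaled_delta:
  fixes g :: "'v \<Rightarrow> 'f::field"
  assumes "finite {u. g u \<noteq> 0}"
  shows "g = (\<Sum>w | g w \<noteq> 0. (\<lambda>u. g w * delta w u))"
proof
  fix x
  have "(\<Sum>w | g w \<noteq> 0. g w * delta w x) = (\<Sum>w | g w \<noteq> 0. if x = w then g w else 0)"
    by (rule sum.cong) (auto simp: delta_def)
  then show "g x = (\<Sum>w | g w \<noteq> 0. (\<lambda>u. g w * delta w u)) x"
    using assms by (simp add: sum_fun_apply)
qed

text \<open>A functional that kills every \<open>\<phi> \<in> \<Phi>\<close> and takes the value 1 at \<open>delta v\<close> yields the solution
  \<open>u \<mapsto> L (delta u)\<close>. It exists as soon as \<open>delta v\<close> is independent of \<open>\<Phi>\<close>; and a dependence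
  \<open>delta v = (\<Sum>a\<in>t. r a * a)\<close> with \<open>t\<close> finite, paired with a solution \<open>f\<close> for \<open>t\<close>, would give
  \<open>f v = 0\<close>. Functionals are taken on the space of all functions, not only the finitely supported ones:
  restricting to the latter would need a type of its own, and the values of a functional on the
  other functions do no harm, since \<open>pairing\<close> reproduces it wherever a coefficient function lives.\<close>

lemma linear_compactness:
  fixes \<Phi> :: "('v \<Rightarrow> 'f::field) set"
  assumes fin: "\<And>\<phi>. \<phi> \<in> \<Phi> \<Longrightarrow> finite {u. \<phi> u \<noteq> 0}"
    and sol: "\<And>T. finite T \<Longrightarrow> T \<subseteq> \<Phi> \<Longrightarrow> \<exists>f. f v \<noteq> 0 \<and> (\<forall>\<phi>\<in>T. pairing f \<phi> = 0)"
  shows "\<exists>f. f v = 1 \<and> (\<forall>\<phi>\<in>\<Phi>. pairing f \<phi> = 0)"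
proof -
  let ?s = "\<lambda>(c::'f) (g::'v \<Rightarrow> 'f) u. c * g u"
  interpret W: vector_space ?s by (rule vector_space_fun)
  interpret P: vector_space_pair ?s "(*) :: 'f \<Rightarrow> 'f \<Rightarrow> 'f"
    by unfold_locales (auto simp: algebra_simps)
  have not_in_span: "delta v \<notin> W.span \<Phi>"
  proof
    assume "delta v \<in> W.span \<Phi>"
    then obtain t r where t: "finite t" "t \<subseteq> \<Phi>" "delta v = (\<Sum>a\<in>t. ?s (r a) a)"
      unfolding W.span_explicit by blast
    obtain f where f: "f v \<noteq> 0" "\<And>\<phi>. \<phi> \<in> t \<Longrightarrow> pairing f \<phi> = 0"
      using sol[OF t(1,2)] by blast
    define A where "A = insert v (\<Union>a\<in>t. {u. a u \<noteq> 0})"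
    have A: "finite A" unfolding A_def using t fin by blast
    have delta_v: "delta v u = (\<Sum>a\<in>t. r a * a u)" for u
      unfolding t(3) by (rule sum_fun_apply)
    have "f v = (\<Sum>u\<in>A. delta v u * f u)"
      using pairing_superset[OF A, of "delta v" f] pairing_delta[of f v]
      by (simp add: supp_delta A_def)
    also have "\<dots> = (\<Sum>u\<in>A. \<Sum>a\<in>t. r a * (a u * f u))"
      by (simp only: delta_v sum_distrib_right mult.assoc)
    also have "\<dots> = (\<Sum>a\<in>t. r a * (\<Sum>u\<in>A. a u * f u))"
      unfolding sum_distrib_left by (rule sum.swap)
    also have "\<dots> = (\<Sum>a\<in>t. r a * pairing f a)"
    proof (intro sum.cong refl arg_cong[where f = "(*) _"])
      fix a assume "a \<in> t"
      then have "{u. a u \<noteq> 0} \<subseteq> A" unfolding A_def by blast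
      then show "(\<Sum>u\<in>A. a u * f u) = pairing f a"
        by (rule pairing_superset[OF A, symmetric])
    qed
    also have "\<dots> = 0" using f(2) by simp
    finally show False using f(1) by simp
  qed
  obtain B where B: "B \<subseteq> \<Phi>" "W.independent B" "\<Phi> \<subseteq> W.span B"
    using W.maximal_independent_subset by blast
  have "delta v \<notin> W.span B" using not_in_span W.span_mono[OF B(1)] by blast
  then have "W.independent (insert (delta v) B)" "delta v \<notin> B"
    using B(2) W.independent_insertI W.span_base by blast+
  then obtain L where L: "Vector_Spaces.linear ?s (*) L"
    and LB: "\<forall>x\<in>insert (delta v) B. L x = (if x = delta v then 1 else 0)"
    using P.linear_independent_extend[of "insert (delta v) B" "\<lambda>x. if x = delta v then 1 else 0"]
    by blast
  interpret L: Vector_Spaces.linear ?s "(*)" L by (rule L)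
  have L_pairing: "pairing (\<lambda>u. L (delta u)) g = L g" if "finite {u. g u \<noteq> 0}" for g
  proof -
    have "L g = L (\<Sum>w | g w \<noteq> 0. ?s (g w) (delta w))"
      by (rule arg_cong[OF sum_scaled_delta[OF that]])
    also have "\<dots> = (\<Sum>w | g w \<noteq> 0. g w * L (delta w))"
      by (simp only: L.sum L.scale)
    finally show ?thesis by (simp add: pairing_def)
  qed
  have "L x = 0" if "x \<in> B" for x
    using LB that \<open>delta v \<notin> B\<close> by auto
  then have L_span: "L x = 0" if "x \<in> W.span B" for x
    using P.linear_eq_0_on_span[OF L _ that] by blast
  have "pairing (\<lambda>u. L (delta u)) \<phi> = 0" if "\<phi> \<in> \<Phi>" for \<phi>
    using L_pairing[OF fin[OF that]] L_span B(3) that by auto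
  moreover have "L (delta v) = 1" using LB by simp
  ultimately show ?thesis by (intro exI[of _ "\<lambda>u. L (delta u)"]) blast
qed

section \<open>Eigenfunctions as solutions of a linear system\<close>

definition vertex_equation :: "'v set set \<Rightarrow> 'f::field \<Rightarrow> 'v \<Rightarrow> 'v \<Rightarrow> 'f" where
  "vertex_equation E \<mu> w = (\<lambda>u. (if u \<in> nbrs E w then 1 else 0) - \<mu> * delta w u)"

lemma supp_vertex_equation:
  "{u. vertex_equation E \<mu> w u \<noteq> 0} \<subseteq> insert w (nbrs E w)"
  by (auto simp: vertex_equation_def delta_def)

lemma pairing_vertex_equation:
  assumes "finite (nbrs E w)"
  shows "pairing f (vertex_equation E \<mu> w) = (\<Sum>u\<in>nbrs E w. f u) - \<mu> * f w"
proof -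
  let ?A = "insert w (nbrs E w)"
  have fin: "finite ?A" using assms by simp
  have "pairing f (vertex_equation E \<mu> w) = (\<Sum>u\<in>?A. vertex_equation E \<mu> w u * f u)"
    by (rule pairing_superset[OF fin supp_vertex_equation])
  also have "\<dots> = (\<Sum>u\<in>?A. if u \<in> nbrs E w then f u else 0) - (\<Sum>u\<in>?A. if u = w then \<mu> * f u else 0)"
    unfolding sum_subtractf[symmetric]
    by (rule sum.cong) (auto simp: vertex_equation_def delta_def algebra_simps)
  also have "(\<Sum>u\<in>?A. if u \<in> nbrs E w then f u else 0) = (\<Sum>u\<in>nbrs E w. f u)"
    using fin by (intro sum.mono_neutral_cong_right) auto
  also have "(\<Sum>u\<in>?A. if u = w then \<mu> * f u else 0) = \<mu> * f w"
    using fin by (subst sum.delta) auto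
  finally show ?thesis .
qed

lemma nbrs_subset: "simple_graph V E \<Longrightarrow> nbrs E w \<subseteq> V"
  by (fastforce simp: simple_graph_def nbrs_def doubleton_eq_iff)

text \<open>Restricting to \<open>V\<close> does not disturb the vertex equations, since edges stay inside \<open>V\<close>; it is
  what makes a solution on the whole type an element of the extensional function space.\<close>

lemma eigenfunction_restrict:
  fixes f :: "'v \<Rightarrow> 'f::field"
  assumes graph: "locally_finite_graph V E" and v: "v \<in> V" "f v \<noteq> 0"
    and eqs: "\<And>w. w \<in> V \<Longrightarrow> pairing f (vertex_equation E \<mu> w) = 0"
  shows "eigenfunction V E \<mu> (restrict f V)"
proof -
  have sub: "nbrs E w \<subseteq> V" for w
    by (rule nbrs_subset) (use graph in \<open>simp add: locally_finite_graph_def\<close>)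
  have "(\<Sum>u\<in>nbrs E w. restrict f V u) = \<mu> * restrict f V w" if "w \<in> V" for w
  proof -
    have "finite (nbrs E w)" using graph that by (simp add: locally_finite_graph_def)
    then have "(\<Sum>u\<in>nbrs E w. f u) = \<mu> * f w"
      using eqs[OF that] by (simp add: pairing_vertex_equation)
    moreover have "(\<Sum>u\<in>nbrs E w. restrict f V u) = (\<Sum>u\<in>nbrs E w. f u)"
      using sub[of w] by (intro sum.cong) auto
    ultimately show ?thesis using that by simp
  qed
  moreover have "restrict f V \<noteq> (\<lambda>v\<in>V. 0)"
  proof
    assume "restrict f V = (\<lambda>v\<in>V. 0)"
    then have "restrict f V v = (\<lambda>v\<in>V. 0) v" by simp
    then show False using v by simp
  qed
  ultimately show ?thesis
    by (auto simp: eigenfunction_def adj_op_def fun_eq_iff)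
qed

lemma eigenfunction_vertex_equation:
  fixes f :: "'v \<Rightarrow> 'f::field"
  assumes "locally_finite_graph V E" "eigenfunction V E \<mu> f" "w \<in> V"
  shows "pairing f (vertex_equation E \<mu> w) = 0"
proof -
  have "finite (nbrs E w)" using assms by (simp add: locally_finite_graph_def)
  moreover have "adj_op V E f w = (\<lambda>v\<in>V. \<mu> * f v) w"
    using assms(2) by (simp add: eigenfunction_def)
  ultimately show ?thesis using assms(3) by (simp add: pairing_vertex_equation adj_op_def)
qed

section \<open>Supports below a chain, and minimal supports\<close>

lemma chain_member_avoiding:
  assumes "finite U" "U \<inter> \<Inter>\<C> = {}" "\<C> \<noteq> {}"
    and chain: "\<And>A B. A \<in> \<C> \<Longrightarrow> B \<in> \<C> \<Longrightarrow> A \<subseteq> B \<or> B \<subseteq> A"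
  shows "\<exists>C\<in>\<C>. U \<inter> C = {}"
  using assms(1,2)
proof (induction U)
  case empty
  then show ?case using assms(3) by auto
next
  case (insert x U)
  obtain C D where CD: "C \<in> \<C>" "U \<inter> C = {}" "D \<in> \<C>" "x \<notin> D"
    using insert by blast
  show ?case
  proof (cases "C \<subseteq> D")
    case True
    then have "insert x U \<inter> C = {}" using CD by blast
    then show ?thesis using CD by blast
  next
    case False
    then have "insert x U \<inter> D = {}" using chain CD by blast
    then show ?thesis using CD by blast
  qed
qed

lemma eigen_support_below_chain:
  fixes \<mu> :: "'f::field" and v :: 'v
  assumes graph: "locally_finite_graph V E"
    and ne: "\<C> \<noteq> {}" and sub: "\<C> \<subseteq> eigen_supports_at V E \<mu> v"
    and chain: "\<And>A B. A \<in> \<C> \<Longrightarrow> B \<in> \<C> \<Longrightarrow> A \<subseteq> B \<or> B \<subseteq> A"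
  shows "\<exists>Y \<subseteq> \<Inter>\<C>. Y \<in> eigen_supports_at V E \<mu> v"
proof -
  define \<Phi> where "\<Phi> = vertex_equation E \<mu> ` V \<union> delta ` (V - \<Inter>\<C>)"
  have fin: "finite {u. \<phi> u \<noteq> 0}" if "\<phi> \<in> \<Phi>" for \<phi>
    using that graph unfolding \<Phi>_def locally_finite_graph_def
    by (auto simp: supp_delta intro: finite_subset[OF supp_vertex_equation])
  have finite_sol: "\<exists>f. f v \<noteq> 0 \<and> (\<forall>\<phi>\<in>T. pairing f \<phi> = 0)" if T: "finite T" "T \<subseteq> \<Phi>" for T
  proof -
    \<comment> \<open>the vertices at which the subsystem \<open>T\<close> prescribes the value 0\<close>
    define U where "U = {u \<in> V - \<Inter>\<C>. delta u \<in> T}"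
    have "finite (delta -` T :: 'v set)"
      using T(1) by (rule finite_vimageI) (rule inj_delta)
    then have "finite U" by (rule rev_finite_subset) (auto simp: U_def)
    then obtain C where C: "C \<in> \<C>" "U \<inter> C = {}"
      using chain_member_avoiding[OF _ _ ne chain, of U] unfolding U_def by blast
    then obtain f where f: "eigenfunction V E \<mu> f" "v \<in> supp V f" "C = supp V f"
      using sub by (auto simp: eigen_supports_at_def)
    have "pairing f \<phi> = 0" if "\<phi> \<in> T" for \<phi>
    proof -
      from that T(2) consider w where "w \<in> V" "\<phi> = vertex_equation E \<mu> w"
        | u where "u \<in> V - \<Inter>\<C>" "\<phi> = delta u" unfolding \<Phi>_def by blast
      then show ?thesis
      proof cases
        case 1
        then show ?thesis using eigenfunction_vertex_equation[OF graph f(1)] by simp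
      next
        case 2
        then have "u \<in> U" using that by (simp add: U_def)
        then have "f u = 0" using C(2) f(3) 2 by (auto simp: supp_def)
        then show ?thesis using 2 by (simp add: pairing_delta)
      qed
    qed
    then show ?thesis using f(2) by (auto simp: supp_def)
  qed
  have "\<exists>f. f v = 1 \<and> (\<forall>\<phi>\<in>\<Phi>. pairing f \<phi> = 0)"
    by (rule linear_compactness) (fact fin finite_sol)+
  then obtain f where f: "f v = 1" "\<And>\<phi>. \<phi> \<in> \<Phi> \<Longrightarrow> pairing f \<phi> = 0"
    by blast
  have v: "v \<in> V" using ne sub by (auto simp: eigen_supports_at_def supp_def)
  let ?g = "restrict f V"
  have "eigenfunction V E \<mu> ?g"
    by (rule eigenfunction_restrict[OF graph v]) (auto simp: f \<Phi>_def)
  moreover have "v \<in> supp V ?g" using f(1) v by (simp add: supp_def)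
  moreover have "supp V ?g \<subseteq> \<Inter>\<C>"
  proof (rule subsetI, rule ccontr)
    fix u assume u: "u \<in> supp V ?g" "u \<notin> \<Inter>\<C>"
    then have "pairing f (delta u) = 0"
      by (intro f(2)) (simp add: \<Phi>_def supp_def)
    then show False using u(1) by (auto simp: pairing_delta supp_def)
  qed
  ultimately show ?thesis unfolding eigen_supports_at_def by blast
qed

lemma minimal_eigen_support:
  assumes graph: "locally_finite_graph V E" and S: "S \<in> eigen_supports_at V E \<mu> v"
  shows "\<exists>M \<subseteq> S. M \<in> eigen_supports_at V E \<mu> v \<and>
           (\<forall>N \<in> eigen_supports_at V E \<mu> v. N \<subseteq> M \<longrightarrow> N = M)"
proof -
  let ?\<A> = "{N \<in> eigen_supports_at V E \<mu> v. N \<subseteq> S}"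
  have "\<exists>M\<in>?\<A>. \<forall>N\<in>?\<A>. M \<supseteq> N \<longrightarrow> N = M"
  proof (rule predicate_Zorn)
    show "partial_order_on ?\<A> (relation_of (\<supseteq>) ?\<A>)"
      by (rule partial_order_on_relation_ofI) auto
  next
    fix \<C> assume "\<C> \<in> Chains (relation_of (\<supseteq>) ?\<A>)"
    then have chain: "\<And>A B. A \<in> \<C> \<Longrightarrow> B \<in> \<C> \<Longrightarrow> A \<subseteq> B \<or> B \<subseteq> A" and sub: "\<C> \<subseteq> ?\<A>"
      by (auto simp: Chains_def relation_of_def)
    show "\<exists>L\<in>?\<A>. \<forall>A\<in>\<C>. A \<supseteq> L"
    proof (cases "\<C> = {}")
      case True
      then show ?thesis using S by blast
    next
      case False
      then obtain Y where "Y \<subseteq> \<Inter>\<C>" "Y \<in> eigen_supports_at V E \<mu> v"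
        using eigen_support_below_chain[OF graph False _ chain, of \<mu> v] sub by blast
      then show ?thesis using False sub by blast
    qed
  qed
  then obtain M where M: "M \<in> ?\<A>" "\<forall>N\<in>?\<A>. M \<supseteq> N \<longrightarrow> N = M" by blast
  then have "N = M" if "N \<in> eigen_supports_at V E \<mu> v" "N \<subseteq> M" for N
    using that by auto
  then show ?thesis using M(1) by auto
qed

theorem mainTheorem10:
  fixes V :: "'v set" and E :: "'v set set" and absv :: "'f::field \<Rightarrow> real"
    and \<mu> :: 'f and v :: 'v
  assumes "locally_finite_graph V E"
    and "absolute_value absv"
    and "v \<in> V"
  shows "(\<forall>(I :: 'i set) (X :: 'i \<Rightarrow> 'v set).
            I \<noteq> {} \<and>
            (\<forall>i\<in>I. \<forall>j\<in>I. X i \<subseteq> X j \<or> X j \<subseteq> X i) \<and>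
            (\<forall>i\<in>I. X i \<in> eigen_supports_at V E \<mu> v) \<longrightarrow>
            (\<exists>Y. Y \<subseteq> (\<Inter>i\<in>I. X i) \<and> Y \<in> eigen_supports_at V E \<mu> v)) \<and>
         (\<forall>S \<in> eigen_supports_at V E \<mu> v.
            \<exists>M. M \<subseteq> S \<and> M \<in> eigen_supports_at V E \<mu> v \<and>
                (\<forall>N \<in> eigen_supports_at V E \<mu> v. N \<subseteq> M \<longrightarrow> N = M))"
proof (intro conjI allI ballI impI)
  fix I :: "'i set" and X :: "'i \<Rightarrow> 'v set"
  assume *: "I \<noteq> {} \<and> (\<forall>i\<in>I. \<forall>j\<in>I. X i \<subseteq> X j \<or> X j \<subseteq> X i) \<and>
    (\<forall>i\<in>I. X i \<in> eigen_supports_at V E \<mu> v)"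
  show "\<exists>Y. Y \<subseteq> (\<Inter>i\<in>I. X i) \<and> Y \<in> eigen_supports_at V E \<mu> v"
    by (rule eigen_support_below_chain[OF assms(1)]) (use * in blast)+
next
  fix S assume "S \<in> eigen_supports_at V E \<mu> v"
  then show "\<exists>M. M \<subseteq> S \<and> M \<in> eigen_supports_at V E \<mu> v \<and>
      (\<forall>N \<in> eigen_supports_at V E \<mu> v. N \<subseteq> M \<longrightarrow> N = M)"
    by (rule minimal_eigen_support[OF assms(1)])
qed

end
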